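(* Let $\mathbb{K}\in\{\mathbb{R},\mathbb{C}\}$, let $L$ be a compact Hausdorff space, and let $\mathcal{A}\subseteq\mathcal{C}(L,\mathbb{K})$ be a self-adjoint algebra over $\mathbb{K}$ that vanishes nowhere on $L$ and such that the equivalence relation $\sim_{\mathcal{A}}$ is finite. Then $\mathcal{C}(L,\mathbb{K})\setminus\overline{\mathcal{A}}$ is $\mathrm{ord}(\sim_{\mathcal{A}})$-lineable but not $(\mathrm{ord}(\sim_{\mathcal{A}})+1)$-lineable.
   Context: $\mathcal{C}(L,\mathbb{K})$ is the Banach space of continuous functions $L\to\mathbb{K}$ with the sup-norm, and $\overline{\mathcal{A}}$ is the norm closure. An algebra (subalgebra) is a linear subspace closed under products (not necessarily containing constants). $\mathcal{A}$ is self-adjoint if $f\in\mathcal{A}$ implies $\overline{f}\in\mathcal{A}$; it vanishes nowhere on $L$ if for every $x\in L$ there is $f\in\mathcal{A}$ with $f(x)\neq 0$. The relation $\sim_{\mathcal{A}}$ on $L$ is defined by $x\sim_{\mathcal{A}}y$ iff $f(x)=f(y)$ for all $f\in\mathcal{A}$. For an equivalence relation $\rho$ on $L$, a set of representatives is a subset $R\subseteq L$ containing exactly one element of each equivalence class; the cardinal $\mathrm{ord}(\rho):=|L\setminus R|$ does not depend on the choice of $R$ and is called the order of $\rho$. The relation $\rho$ is finite if $\mathrm{ord}(\rho)$ is finite. A subset $M$ of a vector space $V$ is $\kappa$-lineable ($\kappa$ a cardinal) if $M\cup\{0\}$ contains a vector subspace of $V$ of (algebraic) dimension $\kappa$ over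 $\mathbb{K}$. *)

theory Defs
  imports "HOL-Analysis.Analysis" "HOL-Library.Function_Algebras"
begin

unbundle cardinal_syntax
no_notation elt_set_eq (infix "=o" 50)

section \<open>Lineability\<close>

definition has_dimension ::
  "('k::field \<Rightarrow> 'v::ab_group_add \<Rightarrow> 'v) \<Rightarrow> 'v set \<Rightarrow> 'c rel \<Rightarrow> bool" where
  "has_dimension sc W \<kappa> \<longleftrightarrow>
    (\<exists>B. B \<subseteq> W \<and> \<not> module.dependent sc B \<and> module.span sc B = W \<and> |B| =o \<kappa>)"

definition lineable ::
  "('k::field \<Rightarrow> 'v::ab_group_add \<Rightarrow> 'v) \<Rightarrow> 'v set \<Rightarrow> 'c rel \<Rightarrow> bool" where
  "lineable sc M \<kappa> \<longleftrightarrow>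
    (\<exists>W. module.subspace sc W \<and> W \<subseteq> M \<union> {0} \<and> has_dimension sc W \<kappa>)"


section \<open>The space of continuous functions\<close>

text \<open>Sums, products and \<open>0\<close> of functions are the pointwise ones of
  \<^theory>\<open>HOL-Library.Function_Algebras\<close>.\<close>

definition fscale :: "'k::field \<Rightarrow> ('a \<Rightarrow> 'k) \<Rightarrow> 'a \<Rightarrow> 'k" where
  "fscale c f = (\<lambda>x. c * f x)"

global_interpretation fun_space: vector_space "fscale :: 'k::field \<Rightarrow> ('a \<Rightarrow> 'k) \<Rightarrow> 'a \<Rightarrow> 'k"
  by standard (auto simp: fscale_def fun_eq_iff algebra_simps)

text \<open>A function on the carrier of \<open>L\<close> is represented by its extension by \<open>0\<close> to the whole
  type, so that equality of elements of \<open>C_space L\<close> is equality of functions on the carrier.\<close>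

definition C_space :: "'a topology \<Rightarrow> ('a \<Rightarrow> 'k::real_normed_field) set" where
  "C_space L = {f. continuous_map L euclidean f \<and> (\<forall>x. x \<notin> topspace L \<longrightarrow> f x = 0)}"

text \<open>Inserting \<open>0\<close> changes the supremum only for the empty space.\<close>

definition sup_norm :: "'a topology \<Rightarrow> ('a \<Rightarrow> 'k::real_normed_field) \<Rightarrow> real" where
  "sup_norm L f = Sup (insert 0 ((\<lambda>x. norm (f x)) ` topspace L))"

text \<open>The value off \<open>C_space L\<close> is a dummy: the library's metric spaces want a distance
  that is nonnegative and symmetric on the whole type.\<close>

definition sup_dist :: "'a topology \<Rightarrow> ('a \<Rightarrow> 'k::real_normed_field) \<Rightarrow> ('a \<Rightarrow> 'k) \<Rightarrow> real" where
  "sup_dist L f g = (if f \<in> C_space L \<and> g \<in> C_space L then sup_norm L (f - g) else 0)"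

definition norm_closure :: "'a topology \<Rightarrow> ('a \<Rightarrow> 'k::real_normed_field) set \<Rightarrow> ('a \<Rightarrow> 'k) set" where
  "norm_closure L A = Metric_space.mtopology (C_space L) (sup_dist L) closure_of A"

lemma bdd_above_C_space:
  assumes "compact_space L" "f \<in> C_space L"
  shows "bdd_above (insert 0 ((\<lambda>x. norm (f x)) ` topspace L))"
proof -
  have "compactin euclidean (f ` topspace L)"
    using assms image_compactin[of L "topspace L" euclidean f]
    by (auto simp: C_space_def compact_space_def)
  then have "bounded (f ` topspace L)"
    by (simp add: compact_imp_bounded)
  then obtain b where "\<forall>x \<in> topspace L. norm (f x) \<le> b"
    by (auto simp: bounded_iff)
  then show ?thesis
    by (auto intro!: bdd_aboveI[of _ b])
qed

lemma C_space_diff: "f \<in> C_space L \<Longrightarrow> g \<in> C_space L \<Longrightarrow> f - g \<in> C_space L"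
  by (auto simp: C_space_def fun_diff_def intro: continuous_map_diff)

lemma sup_norm_upper:
  assumes "compact_space L" "f \<in> C_space L" "x \<in> topspace L"
  shows "norm (f x) \<le> sup_norm L f"
  unfolding sup_norm_def using assms(3)
  by (intro cSup_upper bdd_above_C_space[OF assms(1,2)]) auto

lemma sup_norm_nonneg:
  assumes "compact_space L" "f \<in> C_space L"
  shows "0 \<le> sup_norm L f"
  unfolding sup_norm_def by (intro cSup_upper bdd_above_C_space[OF assms]) auto

lemma sup_norm_least:
  assumes "0 \<le> b" "\<And>x. x \<in> topspace L \<Longrightarrow> norm (f x) \<le> b"
  shows "sup_norm L f \<le> b"
  unfolding sup_norm_def using assms by (intro cSup_least) auto

lemma Metric_space_C_space:
  fixes L :: "'a topology"
  assumes L: "compact_space L"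
  shows "Metric_space (C_space L :: ('a \<Rightarrow> 'k::real_normed_field) set) (sup_dist L)"
proof
  fix f g :: "'a \<Rightarrow> 'k"
  show "0 \<le> sup_dist L f g"
    by (simp add: sup_dist_def sup_norm_nonneg[OF L] C_space_diff)
  show "sup_dist L f g = sup_dist L g f"
    by (simp add: sup_dist_def sup_norm_def norm_minus_commute)
next
  fix f g :: "'a \<Rightarrow> 'k"
  assume f: "f \<in> C_space L" and g: "g \<in> C_space L"
  show "sup_dist L f g = 0 \<longleftrightarrow> f = g"
  proof
    assume "sup_dist L f g = 0"
    then have n0: "sup_norm L (f - g) = 0"
      using f g by (simp add: sup_dist_def)
    show "f = g"
    proof
      fix x
      show "f x = g x"
      proof (cases "x \<in> topspace L")
        case True
        from sup_norm_upper[OF L C_space_diff[OF f g] True] n0 show ?thesis by simp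
      next
        case False
        then show ?thesis using f g by (simp add: C_space_def)
      qed
    qed
  next
    assume "f = g"
    then have "sup_norm L (f - g) \<le> 0"
      by (intro sup_norm_least) auto
    then show "sup_dist L f g = 0"
      using sup_norm_nonneg[OF L C_space_diff[OF f g]] f g by (simp add: sup_dist_def)
  qed
next
  fix f g h :: "'a \<Rightarrow> 'k"
  assume f: "f \<in> C_space L" and g: "g \<in> C_space L" and h: "h \<in> C_space L"
  have "sup_norm L (f - h) \<le> sup_norm L (f - g) + sup_norm L (g - h)"
  proof (rule sup_norm_least)
    show "0 \<le> sup_norm L (f - g) + sup_norm L (g - h)"
      using f g h by (intro add_nonneg_nonneg sup_norm_nonneg[OF L] C_space_diff)
  next
    fix x assume x: "x \<in> topspace L"
    have "norm ((f - h) x) \<le> norm ((f - g) x) + norm ((g - h) x)"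
      using norm_triangle_ineq[of "(f - g) x" "(g - h) x"] by simp
    also have "\<dots> \<le> sup_norm L (f - g) + sup_norm L (g - h)"
      using x f g h by (intro add_mono sup_norm_upper[OF L] C_space_diff)
    finally show "norm ((f - h) x) \<le> sup_norm L (f - g) + sup_norm L (g - h)" .
  qed
  then show "sup_dist L f h \<le> sup_dist L f g + sup_dist L g h"
    using f g h by (simp add: sup_dist_def)
qed

lemma norm_closure_iff:
  assumes "compact_space L" "A \<subseteq> C_space L"
  shows "f \<in> norm_closure L A \<longleftrightarrow>
    f \<in> C_space L \<and> (\<forall>\<epsilon>>0. \<exists>g\<in>A. sup_norm L (f - g) < \<epsilon>)"
proof -
  interpret Metric_space "C_space L :: ('a \<Rightarrow> 'b) set" "sup_dist L"
    by (rule Metric_space_C_space[OF assms(1)])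
  have "g \<in> mball f \<epsilon> \<longleftrightarrow> sup_norm L (f - g) < \<epsilon>" if "f \<in> C_space L" "g \<in> A" for g \<epsilon>
    using that assms(2) by (auto simp: sup_dist_def)
  then show ?thesis
    unfolding norm_closure_def metric_closure_of by blast
qed


section \<open>Algebras of functions\<close>

definition subalgebra :: "'a topology \<Rightarrow> ('a \<Rightarrow> 'k::real_normed_field) set \<Rightarrow> bool" where
  "subalgebra L A \<longleftrightarrow>
    A \<subseteq> C_space L \<and> fun_space.subspace A \<and> (\<forall>f\<in>A. \<forall>g\<in>A. f * g \<in> A)"

text \<open>\<open>cj\<close> is the conjugation of the scalar field: \<^const>\<open>cnj\<close> on the complex numbers,
  \<^const>\<open>id\<close> on the reals.\<close>

definition self_adjoint :: "('k \<Rightarrow> 'k) \<Rightarrow> ('a \<Rightarrow> 'k) set \<Rightarrow> bool" where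
  "self_adjoint cj A \<longleftrightarrow> (\<forall>f\<in>A. (\<lambda>x. cj (f x)) \<in> A)"

definition vanishes_nowhere :: "'a topology \<Rightarrow> ('a \<Rightarrow> 'k::zero) set \<Rightarrow> bool" where
  "vanishes_nowhere L A \<longleftrightarrow> (\<forall>x\<in>topspace L. \<exists>f\<in>A. f x \<noteq> 0)"

definition same_values :: "'a topology \<Rightarrow> ('a \<Rightarrow> 'k) set \<Rightarrow> 'a rel" where
  "same_values L A = {(x, y). x \<in> topspace L \<and> y \<in> topspace L \<and> (\<forall>f\<in>A. f x = f y)}"

lemma equiv_same_values: "equiv (topspace L) (same_values L A)"
  by (auto simp: equiv_def same_values_def refl_on_def sym_def trans_def)


section \<open>The order of an equivalence relation\<close>

definition representatives :: "'a set \<Rightarrow> 'a rel \<Rightarrow> 'a set \<Rightarrow> bool" where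
  "representatives S \<rho> R \<longleftrightarrow> R \<subseteq> S \<and> (\<forall>X \<in> S // \<rho>. \<exists>!x. x \<in> R \<inter> X)"

definition ord_rel :: "'a set \<Rightarrow> 'a rel \<Rightarrow> 'a rel" where
  "ord_rel S \<rho> = |S - (SOME R. representatives S \<rho> R)|"

definition finite_rel :: "'a set \<Rightarrow> 'a rel \<Rightarrow> bool" where
  "finite_rel S \<rho> \<longleftrightarrow> BNF_Cardinal_Arithmetic.cfinite (ord_rel S \<rho>)"

lemma representatives_exist:
  assumes "equiv S \<rho>"
  shows "\<exists>R. representatives S \<rho> R"
proof -
  let ?c = "\<lambda>X. SOME x. x \<in> X"
  have c: "?c X \<in> X" if "X \<in> S // \<rho>" for X
    using in_quotient_imp_non_empty[OF assms that] by (simp add: some_in_eq)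
  have "representatives S \<rho> (?c ` (S // \<rho>))"
    unfolding representatives_def
  proof (intro conjI ballI)
    show "?c ` (S // \<rho>) \<subseteq> S"
      using c in_quotient_imp_subset[OF assms] by blast
    fix X assume X: "X \<in> S // \<rho>"
    show "\<exists>!x. x \<in> ?c ` (S // \<rho>) \<inter> X"
    proof (rule ex1I[of _ "?c X"])
      show "?c X \<in> ?c ` (S // \<rho>) \<inter> X" using c[OF X] X by blast
      fix x assume "x \<in> ?c ` (S // \<rho>) \<inter> X"
      then obtain Y where Y: "Y \<in> S // \<rho>" "x = ?c Y" "x \<in> X" by blast
      then have "x \<in> Y \<inter> X" using c by auto
      then have "Y = X" using quotient_disj[OF assms Y(1) X] by blast
      then show "x = ?c X" using Y(2) by simp
    qed
  qed
  then show ?thesis by blast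
qed

lemma representatives_ex1:
  assumes "representatives S \<rho> R" "x \<in> S"
  shows "\<exists>!y. y \<in> R \<inter> \<rho> `` {x}"
  by (rule bspec[OF conjunct2[OF assms(1)[unfolded representatives_def]] quotientI[OF assms(2)]])

lemma card_of_complement_representatives:
  assumes eq: "equiv S \<rho>" and R: "representatives S \<rho> R" and R': "representatives S \<rho> R'"
  shows "|S - R| \<le>o |S - R'|"
proof -
  define r where "r x = (THE y. y \<in> R \<inter> \<rho> `` {x})" for x
  have r: "r x \<in> R \<inter> \<rho> `` {x}" if "x \<in> S" for x
    unfolding r_def by (rule theI'[OF representatives_ex1[OF R that]])
  have uniq: "x = y" if "(x, y) \<in> \<rho>" "x \<in> Q" "y \<in> Q" "representatives S \<rho> Q" for x y Q
  proof -
    have "x \<in> S" using that by (auto simp: representatives_def)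
    have x: "x \<in> Q \<inter> \<rho> `` {x}" and y: "y \<in> Q \<inter> \<rho> `` {x}"
      using that eq \<open>x \<in> S\<close> by (auto simp: equiv_def refl_on_def)
    show ?thesis
      using representatives_ex1[OF that(4) \<open>x \<in> S\<close>] x y by metis
  qed
  have sym: "(b, a) \<in> \<rho>" if "(a, b) \<in> \<rho>" for a b
    using eq that by (meson equiv_def symD)
  have trans: "(a, c) \<in> \<rho>" if "(a, b) \<in> \<rho>" "(b, c) \<in> \<rho>" for a b c
    using eq that by (meson equiv_def transD)
  have RS: "R \<subseteq> S" using R by (simp add: representatives_def)
  define f where "f x = (if x \<in> R' then r x else x)" for x
  have "inj_on f (S - R)"
  proof (rule inj_onI)
    fix x y assume x: "x \<in> S - R" and y: "y \<in> S - R" and e: "f x = f y"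
    show "x = y"
    proof (cases "x \<in> R' \<and> y \<in> R'")
      case True
      then have "(x, r x) \<in> \<rho>" "(y, r x) \<in> \<rho>"
        using e r[of x] r[of y] x y by (simp_all add: f_def)
      then have "(x, y) \<in> \<rho>" by (rule trans[OF _ sym])
      then show ?thesis using uniq True R' by blast
    next
      case False
      then show ?thesis using e r[of x] r[of y] x y by (cases "x \<in> R'"; cases "y \<in> R'") (simp_all add: f_def)
    qed
  qed
  moreover have "f ` (S - R) \<subseteq> S - R'"
  proof
    fix z assume "z \<in> f ` (S - R)"
    then obtain x where x: "x \<in> S - R" "z = f x" by blast
    show "z \<in> S - R'"
    proof (cases "x \<in> R'")
      case True
      then have z: "z \<in> R" "(x, z) \<in> \<rho>" using r[of x] x by (auto simp: f_def)
      then have "z \<notin> R'" using uniq[OF z(2) True _ R'] x by blast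
      then show ?thesis using z RS by blast
    next
      case False
      then show ?thesis using x by (simp add: f_def)
    qed
  qed
  ultimately show ?thesis using card_of_ordLeq[of "S - R" "S - R'"] by blast
qed

lemma ord_rel_eq:
  assumes "equiv S \<rho>" "representatives S \<rho> R"
  shows "ord_rel S \<rho> =o |S - R|"
proof -
  have "representatives S \<rho> (SOME R. representatives S \<rho> R)"
    by (rule someI_ex[OF representatives_exist[OF assms(1)]])
  then show ?thesis
    unfolding ord_rel_def ordIso_iff_ordLeq
    by (intro conjI card_of_complement_representatives[OF assms(1)] assms(2))
qed

end

theory Submission
  imports Defs
begin

text \<open>
  The closure of \<open>A\<close> is the space \<open>N\<close> of all continuous functions that are constant on the
  classes of \<open>\<sim>\<^sub>A\<close>, and \<open>N\<close> is the kernel of a linear map onto \<open>K\<^sup>E\<close>, where \<open>E\<close> is the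
  complement of a set of representatives. Hence \<open>N\<close> has codimension \<open>|E|\<close>: a linear
  complement of \<open>N\<close> is a space of dimension \<open>|E|\<close> that meets \<open>N\<close> in \<open>0\<close> only, and on any
  space meeting \<open>N\<close> in \<open>0\<close> only the linear map is injective, which bounds the dimension.

  The description of the closure is the Stone--Weierstrass theorem without separation of points
  and without constants. Evaluation sends \<open>x\<close> to the family of all values \<open>f x\<close> with \<open>f \<in> A\<close>; it
  maps \<open>L\<close> onto a compact Hausdorff space \<open>S\<close> whose points are the classes of \<open>\<sim>\<^sub>A\<close>, and the
  coordinates separate the points of \<open>S\<close>. The classical theorem on \<open>S\<close> then yields
  approximation by functions \<open>a + c\<close> with \<open>a \<in> A\<close> and \<open>c\<close> constant
  (\<open>approximation_up_to_constants\<close>). To remove the constants, take \<open>p \<in> A\<close> that is positive on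
  all of \<open>L\<close> (\<open>ex_positive_member\<close>) and write \<open>h = p \<cdot> (h / p)\<close>: if \<open>a + c\<close> is close to
  \<open>h / p\<close>, then \<open>a p + c p \<in> A\<close> is close to \<open>h\<close> (\<open>real_approximation\<close>). In the complex case,
  self-adjointness reduces the claim to the real algebra of real-valued members of \<open>A\<close>
  (\<open>complex_approximation\<close>).

  The linear map sends \<open>f\<close> to the family \<open>f e - f (r e)\<close> for \<open>e \<in> E\<close>, where \<open>r e\<close> is the
  representative of \<open>e\<close>. It is onto because Urysohn's lemma gives continuous functions with
  prescribed values at finitely many points (\<open>lineability_of_complement\<close>).
\<close>

section \<open>Separation in product spaces\<close>

text \<open>The separation axioms of a product follow from those of the factors: distinct functions
  differ in a coordinate, and coordinates are continuous. The Hausdorff instance makes the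
  Stone--Weierstrass theorem applicable to compact sets of functions; its two predecessors are
  there because the type classes form a chain.\<close>

lemma open_vimage_coordinate:
  fixes W :: "'b::topological_space set"
  assumes "open W"
  shows "open ((\<lambda>h :: 'a \<Rightarrow> 'b. h i) -` W)"
  using assms by (intro open_vimage continuous_on_product_coordinates)

instance "fun" :: (type, t0_space) t0_space
proof
  fix f g :: "'a \<Rightarrow> 'b"
  assume "f \<noteq> g"
  then obtain i where i: "f i \<noteq> g i" by auto
  obtain U where "open U" "\<not> (f i \<in> U \<longleftrightarrow> g i \<in> U)"
    using Topological_Spaces.t0_space[OF i] by (elim exE conjE) (rule that)
  then show "\<exists>U. open U \<and> \<not> (f \<in> U \<longleftrightarrow> g \<in> U)"
    by (intro exI[of _ "(\<lambda>h. h i) -` U"]) (simp add: open_vimage_coordinate)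
qed

instance "fun" :: (type, t1_space) t1_space
proof
  fix f g :: "'a \<Rightarrow> 'b"
  assume "f \<noteq> g"
  then obtain i where "f i \<noteq> g i" by auto
  then obtain U where "open U" "f i \<in> U" "g i \<notin> U"
    by (meson t1_space)
  then show "\<exists>U. open U \<and> f \<in> U \<and> g \<notin> U"
    by (intro exI[of _ "(\<lambda>h. h i) -` U"]) (simp add: open_vimage_coordinate)
qed

instance "fun" :: (type, t2_space) t2_space
proof
  fix f g :: "'a \<Rightarrow> 'b"
  assume "f \<noteq> g"
  then obtain i where "f i \<noteq> g i" by auto
  then obtain U V where "open U" "open V" "f i \<in> U" "g i \<in> V" "U \<inter> V = {}"
    by (meson hausdorff)
  then show "\<exists>U V. open U \<and> open V \<and> f \<in> U \<and> g \<in> V \<and> U \<inter> V = {}"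
    by (intro exI[of _ "(\<lambda>h. h i) -` U"] exI[of _ "(\<lambda>h. h i) -` V"])
      (auto simp: open_vimage_coordinate)
qed

section \<open>Stone--Weierstrass without separation of points\<close>

lemma subalgebra_closed:
  assumes "subalgebra L A"
  shows "f \<in> A \<Longrightarrow> f \<in> C_space L" "f \<in> A \<Longrightarrow> g \<in> A \<Longrightarrow> f + g \<in> A"
    "f \<in> A \<Longrightarrow> g \<in> A \<Longrightarrow> f * g \<in> A" "f \<in> A \<Longrightarrow> fscale c f \<in> A" "0 \<in> A"
  using assms by (auto simp: subalgebra_def fun_space.subspace_def)

text \<open>The compact space \<open>L\<close> is replaced by its image \<open>S\<close> under evaluation, on which the
  classical theorem applies to the functions whose pullback to \<open>L\<close> is in \<open>A\<close> up to a constant. A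
  function that is constant on classes descends to \<open>S\<close>, and continuity descends too because a
  continuous map from a compact space to a Hausdorff space is closed, so a quotient map.\<close>

lemma approximation_up_to_constants:
  fixes A :: "('a \<Rightarrow> real) set"
  assumes L: "compact_space L" and A: "subalgebra L A"
    and h: "continuous_map L euclideanreal h"
    and resp: "\<And>x y. (x, y) \<in> same_values L A \<Longrightarrow> h x = h y"
    and \<epsilon>: "\<epsilon> > 0"
  shows "\<exists>a\<in>A. \<exists>c. \<forall>x\<in>topspace L. \<bar>h x - (a x + c)\<bar> < \<epsilon>"
proof -
  \<comment> \<open>The coordinates are indexed by all functions; those outside \<open>A\<close> are set to \<open>0\<close> so that they
    neither separate points nor destroy continuity.\<close>
  define \<Phi> :: "'a \<Rightarrow> ('a \<Rightarrow> real) \<Rightarrow> real" where "\<Phi> x f = (if f \<in> A then f x else 0)" for x f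
  define S where "S = \<Phi> ` topspace L"
  note A' = subalgebra_closed[OF A]
  have eval: "\<Phi> x f = f x" if "f \<in> A" for x f
    using that by (simp add: \<Phi>_def)
  have fibre: "(x, y) \<in> same_values L A" if "x \<in> topspace L" "y \<in> topspace L" "\<Phi> x = \<Phi> y" for x y
    using that eval by (auto simp: same_values_def) metis
  have "continuous_map L euclideanreal (\<lambda>x. \<Phi> x f)" for f
    using A'(1)[of f] by (cases "f \<in> A") (auto simp: \<Phi>_def C_space_def cong: if_cong)
  then have cont: "continuous_map L euclidean \<Phi>"
    unfolding euclidean_product_topology[symmetric]
    by (simp add: continuous_map_componentwise_UNIV)
  have "compact S"
    using image_compactin[OF L[unfolded compact_space_def] cont] by (simp add: S_def)
  have contS: "continuous_map L (top_of_set S) \<Phi>"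
    using cont by (auto simp: continuous_map_in_subtopology S_def)
  have quot: "quotient_map L (top_of_set S) \<Phi>"
  proof (rule continuous_closed_imp_quotient_map[OF contS])
    show "closed_map L (top_of_set S) \<Phi>"
    proof (unfold closed_map_def, intro allI impI)
      fix U assume "closedin L U"
      then have "compact (\<Phi> ` U)"
        using image_compactin[OF _ cont] closedin_compact_space[OF L] by auto
      moreover have "\<Phi> ` U \<subseteq> S"
        using closedin_subset[OF \<open>closedin L U\<close>] by (auto simp: S_def)
      ultimately show "closedin (top_of_set S) (\<Phi> ` U)"
        by (simp add: closed_subset compact_imp_closed)
    qed
  qed (simp add: S_def)
  \<comment> \<open>\<open>u\<close> is the function on \<open>S\<close> with \<open>u \<circ> \<Phi> = h\<close>.\<close>
  define u where "u \<phi> = h (SOME x. x \<in> topspace L \<and> \<Phi> x = \<phi>)" for \<phi>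
  have u: "u (\<Phi> x) = h x" if "x \<in> topspace L" for x
  proof -
    have "(SOME y. y \<in> topspace L \<and> \<Phi> y = \<Phi> x) \<in> topspace L \<and>
        \<Phi> (SOME y. y \<in> topspace L \<and> \<Phi> y = \<Phi> x) = \<Phi> x"
      by (rule someI[of _ x]) (use that in auto)
    then show ?thesis
      unfolding u_def using that by (intro resp fibre) auto
  qed
  have "continuous_map L euclideanreal (u \<circ> \<Phi>)"
    by (rule continuous_map_eq[OF h]) (simp add: u)
  then have "continuous_map (top_of_set S) euclideanreal u"
    by (rule continuous_compose_quotient_map[OF quot])
  then have "continuous_on S u"
    by simp
  define P where "P v \<longleftrightarrow> continuous_on S v \<and>
    (\<exists>a\<in>A. \<exists>c. \<forall>x\<in>topspace L. v (\<Phi> x) = a x + c)" for v :: "(('a \<Rightarrow> real) \<Rightarrow> real) \<Rightarrow> real"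
  have "\<exists>g. P g \<and> (\<forall>x\<in>S. \<bar>u x - g x\<bar> < \<epsilon>)"
  proof (rule Stone_Weierstrass_HOL[OF \<open>compact S\<close>])
    fix c :: real
    show "P (\<lambda>x. c)"
      using A'(5) by (auto simp: P_def intro!: bexI[of _ 0])
  next
    fix f g assume "P f \<and> P g"
    then obtain a b c d where ab: "a \<in> A" "b \<in> A" and c: "continuous_on S f" "continuous_on S g"
      and f: "\<And>x. x \<in> topspace L \<Longrightarrow> f (\<Phi> x) = a x + c"
      and g: "\<And>x. x \<in> topspace L \<Longrightarrow> g (\<Phi> x) = b x + d"
      unfolding P_def by metis
    show "P (\<lambda>x. f x + g x)"
      unfolding P_def
      by (intro conjI continuous_intros c bexI[of _ "a + b"] exI[of _ "c + d"] A' ab)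
        (auto simp: f g)
    show "P (\<lambda>x. f x * g x)"
      unfolding P_def
      by (intro conjI continuous_intros c bexI[of _ "a * b + (fscale d a + fscale c b)"]
          exI[of _ "c * d"] A' ab)
        (auto simp: f g fscale_def algebra_simps)
  next
    fix \<phi> \<psi> assume "\<phi> \<in> S \<and> \<psi> \<in> S \<and> \<phi> \<noteq> \<psi>"
    then obtain x y where xy: "\<phi> = \<Phi> x" "\<psi> = \<Phi> y" "\<Phi> x \<noteq> \<Phi> y"
      by (auto simp: S_def)
    then obtain f where f: "f \<in> A" "f x \<noteq> f y"
      by (auto simp: \<Phi>_def fun_eq_iff split: if_splits)
    have "continuous_on S (\<lambda>\<phi>. \<phi> f)"
      by (rule continuous_on_subset[OF continuous_on_product_coordinates]) simp
    then have "P (\<lambda>\<phi>. \<phi> f)"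
      unfolding P_def using f by (intro conjI bexI[of _ f] exI[of _ 0]) (auto simp: eval)
    then show "\<exists>v. P v \<and> v \<phi> \<noteq> v \<psi>"
      using f xy by (intro exI[of _ "\<lambda>\<phi>. \<phi> f"]) (auto simp: eval)
  qed (use \<open>continuous_on S u\<close> \<epsilon> in \<open>auto simp: P_def\<close>)
  then obtain g where g: "P g" "\<And>x. x \<in> S \<Longrightarrow> \<bar>u x - g x\<bar> < \<epsilon>"
    by auto
  from g(1) obtain a c where ac: "a \<in> A" "\<And>x. x \<in> topspace L \<Longrightarrow> g (\<Phi> x) = a x + c"
    unfolding P_def by metis
  have "\<bar>h x - (a x + c)\<bar> < \<epsilon>" if "x \<in> topspace L" for x
    using g(2)[of "\<Phi> x"] that u ac(2) by (simp add: S_def)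
  then show ?thesis using ac(1) by blast
qed

lemma sum_fun_apply: "(sum f I) x = (\<Sum>i\<in>I. f i x)" for f :: "'i \<Rightarrow> 'a \<Rightarrow> 'b::comm_monoid_add"
  by (induction I rule: infinite_finite_induct) auto

text \<open>For each point some square of a member of \<open>A\<close> is positive near it; by compactness, finitely
  many such squares have a sum that is positive everywhere.\<close>

lemma ex_positive_member:
  fixes A :: "('a \<Rightarrow> real) set"
  assumes L: "compact_space L" and A: "subalgebra L A" and van: "vanishes_nowhere L A"
  shows "\<exists>p\<in>A. \<forall>x\<in>topspace L. p x > 0"
proof -
  obtain F where F: "\<And>x. x \<in> topspace L \<Longrightarrow> F x \<in> A" "\<And>x. x \<in> topspace L \<Longrightarrow> F x x \<noteq> 0"
    using van unfolding vanishes_nowhere_def by metis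
  define U where "U x = {y \<in> topspace L. F x y \<in> - {0}}" for x
  have "openin L (U x)" if "x \<in> topspace L" for x
    unfolding U_def
    by (rule openin_continuous_map_preimage[where Y = euclidean])
      (use subalgebra_closed(1)[OF A F(1)[OF that]] in \<open>auto simp: C_space_def\<close>)
  moreover have "topspace L \<subseteq> \<Union> (U ` topspace L)"
    using F by (auto simp: U_def)
  ultimately obtain \<F> where "finite \<F>" "\<F> \<subseteq> U ` topspace L" "topspace L \<subseteq> \<Union>\<F>"
    using L unfolding compact_space_alt by (metis (no_types, lifting) imageE)
  then obtain T where T: "finite T" "T \<subseteq> topspace L" "topspace L \<subseteq> \<Union> (U ` T)"
    by (metis finite_subset_image)
  define p where "p = (\<Sum>t\<in>T. F t * F t)"
  have "p \<in> A"
    unfolding p_def using T(2) F(1) A subalgebra_closed(3)[OF A]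
    by (intro fun_space.subspace_sum) (auto simp: subalgebra_def)
  moreover have "p y > 0" if "y \<in> topspace L" for y
  proof -
    from that T obtain t where "t \<in> T" "F t y \<noteq> 0" by (auto simp: U_def)
    then show ?thesis
      using T(1) unfolding p_def sum_fun_apply
      by (intro sum_pos2[of _ t]) (auto simp: zero_less_mult_iff)
  qed
  ultimately show ?thesis by blast
qed

text \<open>Multiplying by a positive \<open>p \<in> A\<close> turns an approximation of \<open>h / p\<close> up to a constant into
  an approximation of \<open>h\<close> within \<open>A\<close>, at the cost of a factor bounding \<open>p\<close>.\<close>

lemma real_approximation:
  fixes A :: "('a \<Rightarrow> real) set"
  assumes L: "compact_space L" and A: "subalgebra L A" and van: "vanishes_nowhere L A"
    and h: "continuous_map L euclideanreal h"
    and resp: "\<And>x y. (x, y) \<in> same_values L A \<Longrightarrow> h x = h y"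
    and \<epsilon>: "\<epsilon> > 0"
  shows "\<exists>g\<in>A. \<forall>x\<in>topspace L. \<bar>h x - g x\<bar> < \<epsilon>"
proof -
  note A' = subalgebra_closed[OF A]
  obtain p where p: "p \<in> A" "\<And>x. x \<in> topspace L \<Longrightarrow> p x > 0"
    using ex_positive_member[OF L A van] by blast
  \<comment> \<open>The summand \<open>1\<close> keeps the bound positive when \<open>L\<close> is empty.\<close>
  define M where "M = sup_norm L p + 1"
  have M: "M > 0" "\<And>x. x \<in> topspace L \<Longrightarrow> p x \<le> M"
    using sup_norm_nonneg[OF L A'(1)[OF p(1)]] sup_norm_upper[OF L A'(1)[OF p(1)]]
    by (fastforce simp: M_def)+
  have "continuous_map L euclideanreal (\<lambda>x. h x / p x)"
    using h A'(1)[OF p(1)] p(2) by (intro continuous_map_real_divide) (auto simp: C_space_def less_imp_neq[THEN not_sym])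
  moreover have "h x / p x = h y / p y" if "(x, y) \<in> same_values L A" for x y
    using resp[OF that] that p(1) by (simp add: same_values_def)
  moreover have "\<epsilon> / M > 0"
    using \<epsilon> M(1) by simp
  ultimately have "\<exists>a\<in>A. \<exists>c. \<forall>x\<in>topspace L. \<bar>h x / p x - (a x + c)\<bar> < \<epsilon> / M"
    by (rule approximation_up_to_constants[OF L A])
  then obtain a c where a: "a \<in> A"
    and ac: "\<And>x. x \<in> topspace L \<Longrightarrow> \<bar>h x / p x - (a x + c)\<bar> < \<epsilon> / M"
    by blast
  have "a * p + fscale c p \<in> A"
    by (intro A'(2-4) a p(1))
  moreover have "\<bar>h x - (a * p + fscale c p) x\<bar> < \<epsilon>" if x: "x \<in> topspace L" for x
  proof -
    have "\<bar>h x - (a * p + fscale c p) x\<bar> = \<bar>(h x / p x - (a x + c)) * p x\<bar>"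
      using p(2)[OF x] by (simp add: fscale_def algebra_simps)
    also have "\<dots> = \<bar>h x / p x - (a x + c)\<bar> * p x"
      using p(2)[OF x] by (simp add: abs_mult)
    also have "\<dots> < \<epsilon> / M * p x"
      using ac[OF x] p(2)[OF x] by (rule mult_strict_right_mono)
    also have "\<dots> \<le> \<epsilon> / M * M"
      using M(1) M(2)[OF x] \<epsilon> by (intro mult_left_mono) auto
    finally show ?thesis using M(1) by simp
  qed
  ultimately show ?thesis by blast
qed

text \<open>Self-adjointness puts the real and imaginary parts of members of \<open>A\<close> back into \<open>A\<close>. So the
  real-valued members form a real algebra with the same classes and the same common zeros, and
  the real and imaginary parts of \<open>h\<close> can be approximated separately.\<close>

lemma complex_approximation:
  fixes A :: "('a \<Rightarrow> complex) set"
  assumes L: "compact_space L" and A: "subalgebra L A" and sa: "self_adjoint cnj A"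
    and van: "vanishes_nowhere L A"
    and h: "continuous_map L euclidean h"
    and resp: "\<And>x y. (x, y) \<in> same_values L A \<Longrightarrow> h x = h y"
    and \<epsilon>: "\<epsilon> > 0"
  shows "\<exists>g\<in>A. \<forall>x\<in>topspace L. cmod (h x - g x) < \<epsilon>"
proof -
  note A' = subalgebra_closed[OF A]
  define B where "B = {u. (\<lambda>x. complex_of_real (u x)) \<in> A}"
  have Re_eq: "(\<lambda>x. complex_of_real (Re (f x))) = fscale (1/2) (f + (\<lambda>x. cnj (f x)))"
    for f :: "'a \<Rightarrow> complex"
    by (simp add: fun_eq_iff fscale_def complex_eq_iff)
  have Re: "(\<lambda>x. Re (f x)) \<in> B" if "f \<in> A" for f
    unfolding B_def mem_Collect_eq Re_eq
    using that sa by (intro A'(2,4)) (auto simp: self_adjoint_def)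
  have Im: "(\<lambda>x. Im (f x)) \<in> B" if "f \<in> A" for f
    \<comment> \<open>The imaginary part of \<open>f\<close> is the real part of \<open>- \<i> f\<close>.\<close>
    using Re[OF A'(4)[OF that, of "- \<i>"]] by (simp add: fscale_def)
  have B: "subalgebra L B"
    unfolding subalgebra_def fun_space.subspace_def
  proof (intro conjI ballI allI subsetI)
    fix u assume "u \<in> B"
    then have *: "(\<lambda>x. complex_of_real (u x)) \<in> C_space L" using A'(1) by (simp add: B_def)
    have "continuous_map L euclideanreal (Re \<circ> (\<lambda>x. complex_of_real (u x)))"
      using * by (intro continuous_map_compose[where X' = euclidean])
        (auto simp: C_space_def intro: continuous_on_Re continuous_on_id)
    then show "u \<in> C_space L" using * by (simp add: C_space_def o_def)
  next
    show "0 \<in> B" using A'(5) by (simp add: B_def zero_fun_def)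
  next
    fix u v assume uv: "u \<in> B" "v \<in> B"
    show "u + v \<in> B" "u * v \<in> B"
      using uv A'(2,3)[of "\<lambda>x. complex_of_real (u x)" "\<lambda>x. complex_of_real (v x)"]
      by (simp_all add: B_def plus_fun_def times_fun_def)
  next
    fix u c assume "u \<in> B"
    then show "fscale c u \<in> B"
      using A'(4)[of "\<lambda>x. complex_of_real (u x)" "complex_of_real c"]
      by (simp add: B_def fscale_def)
  qed
  have vanB: "vanishes_nowhere L B"
    unfolding vanishes_nowhere_def
  proof
    fix x assume "x \<in> topspace L"
    then obtain f where f: "f \<in> A" "f x \<noteq> 0"
      using van by (auto simp: vanishes_nowhere_def)
    then show "\<exists>u\<in>B. u x \<noteq> 0"
      using Re[OF f(1)] Im[OF f(1)] by (auto simp: complex_eq_iff)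
  qed
  have respB: "h x = h y" if "(x, y) \<in> same_values L B" for x y
  proof (rule resp)
    have "f x = f y" if "f \<in> A" for f
      using \<open>(x, y) \<in> same_values L B\<close> Re[OF that] Im[OF that]
      by (auto simp: same_values_def complex_eq_iff)
    then show "(x, y) \<in> same_values L A"
      using that by (auto simp: same_values_def)
  qed
  have "continuous_map L euclideanreal (Re \<circ> h)" "continuous_map L euclideanreal (Im \<circ> h)"
    by (rule continuous_map_compose[OF h];
      auto intro: continuous_on_Re continuous_on_Im continuous_on_id)+
  then have "\<exists>u\<in>B. \<forall>x\<in>topspace L. \<bar>(Re \<circ> h) x - u x\<bar> < \<epsilon> / 2"
    "\<exists>u\<in>B. \<forall>x\<in>topspace L. \<bar>(Im \<circ> h) x - u x\<bar> < \<epsilon> / 2"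
    using \<epsilon> respB by (intro real_approximation[OF L B vanB]; simp add: o_def)+
  then obtain u v where uv: "u \<in> B" "v \<in> B"
    and u: "\<And>x. x \<in> topspace L \<Longrightarrow> \<bar>Re (h x) - u x\<bar> < \<epsilon> / 2"
    and v: "\<And>x. x \<in> topspace L \<Longrightarrow> \<bar>Im (h x) - v x\<bar> < \<epsilon> / 2"
    by auto
  define g where "g = (\<lambda>x. complex_of_real (u x)) + fscale \<i> (\<lambda>x. complex_of_real (v x))"
  have "g \<in> A"
    unfolding g_def using uv by (intro A'(2,4)) (auto simp: B_def)
  moreover have "cmod (h x - g x) < \<epsilon>" if "x \<in> topspace L" for x
    using cmod_le[of "h x - g x"] u[OF that] v[OF that] by (simp add: g_def fscale_def)
  ultimately show ?thesis by blast
qed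

text \<open>One inclusion holds for every set of continuous functions, as equality of the values at two given points
  survives uniform limits; the other is the approximation property.\<close>

lemma norm_closure_eq_constant_on_classes:
  fixes A :: "('a \<Rightarrow> 'k::real_normed_field) set"
  assumes L: "compact_space L" and A: "A \<subseteq> C_space L"
    and approx: "\<And>h \<epsilon>. \<lbrakk>continuous_map L euclidean h;
        \<And>x y. (x, y) \<in> same_values L A \<Longrightarrow> h x = h y; \<epsilon> > 0\<rbrakk>
      \<Longrightarrow> \<exists>g\<in>A. \<forall>x\<in>topspace L. norm (h x - g x) < \<epsilon>"
  shows "norm_closure L A = {f \<in> C_space L. \<forall>(x, y)\<in>same_values L A. f x = f y}"
proof (intro equalityI subsetI)
  fix f assume f: "f \<in> norm_closure L A"
  then have fC: "f \<in> C_space L"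
    by (simp add: norm_closure_iff[OF L A])
  have "f x = f y" if xy: "(x, y) \<in> same_values L A" for x y
  proof (rule ccontr)
    assume "f x \<noteq> f y"
    then have "norm (f x - f y) / 2 > 0" by simp
    then obtain g where g: "g \<in> A" "sup_norm L (f - g) < norm (f x - f y) / 2"
      using f unfolding norm_closure_iff[OF L A] by blast
    have x: "x \<in> topspace L" and y: "y \<in> topspace L" and "g x = g y"
      using xy g(1) by (auto simp: same_values_def)
    have "norm (f x - f y) = norm ((f - g) x - (f - g) y)"
      using \<open>g x = g y\<close> by simp
    also have "\<dots> \<le> norm ((f - g) x) + norm ((f - g) y)"
      by (rule norm_triangle_ineq4)
    also have "\<dots> \<le> sup_norm L (f - g) + sup_norm L (f - g)"
      using g(1) A by (intro add_mono sup_norm_upper[OF L] C_space_diff fC x y) auto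
    finally show False using g(2) by simp
  qed
  then show "f \<in> {f \<in> C_space L. \<forall>(x, y)\<in>same_values L A. f x = f y}"
    using fC by auto
next
  fix f :: "'a \<Rightarrow> 'k" assume f: "f \<in> {f \<in> C_space L. \<forall>(x, y)\<in>same_values L A. f x = f y}"
  have "\<exists>g\<in>A. sup_norm L (f - g) < \<epsilon>" if \<epsilon>: "\<epsilon> > 0" for \<epsilon>
  proof -
    have "\<exists>g\<in>A. \<forall>x\<in>topspace L. norm (f x - g x) < \<epsilon> / 2"
      by (rule approx) (use f \<epsilon> in \<open>auto simp: C_space_def\<close>)
    then obtain g where g: "g \<in> A" "\<And>x. x \<in> topspace L \<Longrightarrow> norm (f x - g x) < \<epsilon> / 2"
      by blast
    have "sup_norm L (f - g) \<le> \<epsilon> / 2"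
      using g(2) \<epsilon> by (intro sup_norm_least) (auto intro: less_imp_le)
    then show ?thesis using g(1) \<epsilon> by (intro bexI[of _ g]) auto
  qed
  then show "f \<in> norm_closure L A"
    using f by (simp add: norm_closure_iff[OF L A])
qed

section \<open>Lineability of the complement of a kernel\<close>

text \<open>The standard basis of \<open>K\<^sup>E\<close>, realised inside the space of all functions: functions
  supported in \<open>E\<close> stand for families indexed by \<open>E\<close>.\<close>

definition point_mass :: "'a \<Rightarrow> 'a \<Rightarrow> 'k::field" where
  "point_mass e = (\<lambda>x. if x = e then 1 else 0)"

lemma inj_point_mass: "inj (point_mass :: 'a \<Rightarrow> 'a \<Rightarrow> 'k::field)"
  by (rule injI) (metis point_mass_def zero_neq_one)

lemma independent_point_masses:
  assumes "finite E"
  shows "fun_space.independent (point_mass ` E :: ('a \<Rightarrow> 'k::field) set)"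
proof (rule fun_space.independent_if_scalars_zero)
  fix c :: "('a \<Rightarrow> 'k) \<Rightarrow> 'k" and v :: "'a \<Rightarrow> 'k"
  assume sum0: "(\<Sum>v\<in>point_mass ` E. fscale (c v) v) = 0" and "v \<in> point_mass ` E"
  then obtain e where e: "e \<in> E" "v = point_mass e" by blast
  have "(\<Sum>v\<in>point_mass ` E. fscale (c v) v) = (\<Sum>e'\<in>E. fscale (c (point_mass e')) (point_mass e'))"
    using inj_on_subset[OF inj_point_mass] by (subst sum.reindex) auto
  then have "0 = (\<Sum>e'\<in>E. fscale (c (point_mass e')) (point_mass e' :: 'a \<Rightarrow> 'k)) e"
    using sum0 by simp
  also have "\<dots> = (\<Sum>e'\<in>E. if e' = e then c v else 0)"
    unfolding sum_fun_apply by (rule sum.cong) (auto simp: fscale_def point_mass_def e(2))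
  also have "\<dots> = c v"
    using e(1) assms by simp
  finally show "c v = 0" by simp
qed (use assms in simp)

lemma span_point_masses:
  fixes f :: "'a \<Rightarrow> 'k::field"
  assumes "finite E" and "\<And>x. x \<notin> E \<Longrightarrow> f x = 0"
  shows "f \<in> fun_space.span (point_mass ` E)"
proof -
  have "f = (\<Sum>e\<in>E. fscale (f e) (point_mass e))"
  proof
    fix x
    have "(\<Sum>e\<in>E. fscale (f e) (point_mass e)) x = (\<Sum>e\<in>E. if e = x then f x else 0)"
      unfolding sum_fun_apply by (rule sum.cong) (auto simp: fscale_def point_mass_def)
    then show "f x = (\<Sum>e\<in>E. fscale (f e) (point_mass e)) x"
      using assms by simp
  qed
  moreover have "(\<Sum>e\<in>E. fscale (f e) (point_mass e)) \<in> fun_space.span (point_mass ` E)"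
    by (intro fun_space.span_sum fun_space.span_scale fun_space.span_base) auto
  ultimately show ?thesis by simp
qed

text \<open>Preimages in \<open>V\<close> of the standard basis of \<open>K\<^sup>E\<close> are independent, and \<open>T\<close> is injective
  on their span. So the span meets the kernel in \<open>0\<close> only.\<close>

lemma lineable_complement_of_kernel:
  fixes T :: "('a \<Rightarrow> 'k::field) \<Rightarrow> 'a \<Rightarrow> 'k"
  assumes T: "Vector_Spaces.linear fscale fscale T" and V: "fun_space.subspace V"
    and onto: "\<And>e. e \<in> E \<Longrightarrow> \<exists>g\<in>V. T g = point_mass e" and E: "finite E"
  shows "lineable fscale (V - {f \<in> V. T f = 0}) |E|"
proof -
  interpret T: Vector_Spaces.linear fscale fscale T by (rule T)
  obtain g where g: "\<And>e. e \<in> E \<Longrightarrow> g e \<in> V" "\<And>e. e \<in> E \<Longrightarrow> T (g e) = point_mass e"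
    using onto by metis
  have img: "T ` g ` E = point_mass ` E"
    using g(2) by (auto simp: image_image)
  have inj: "inj_on (T \<circ> g) E"
    using g(2) inj_on_subset[OF inj_point_mass, of E]
    by (auto simp: inj_on_def)
  have injT: "inj_on T (fun_space.span (g ` E))"
    using T.inj_on_span_independent_image[of "g ` E"] inj_on_imageI[OF inj]
    by (simp add: img independent_point_masses[OF E])
  have "fun_space.independent (g ` E)"
  proof
    assume "fun_space.dependent (g ` E)"
    then obtain a where a: "a \<in> g ` E" "a \<in> fun_space.span (g ` E - {a})"
      by (auto simp: fun_space.dependent_def)
    have "T a \<in> fun_space.span (T ` (g ` E - {a}))"
      using a(2) by (simp add: T.span_image)
    moreover have "T ` (g ` E - {a}) = T ` g ` E - {T a}"
      using inj_on_image_set_diff[of T "g ` E" "g ` E" "{a}"] inj_on_imageI[OF inj] a(1) by auto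
    ultimately have "fun_space.dependent (T ` g ` E)"
      using a(1) by (auto simp: fun_space.dependent_def)
    then show False
      by (simp add: img independent_point_masses[OF E])
  qed
  moreover have "|g ` E| =o |E|"
    using inj_on_imageI2[OF inj] card_of_ordIso inj_on_imp_bij_betw ordIso_symmetric by blast
  moreover have "fun_space.span (g ` E) \<subseteq> V"
    using g(1) V by (intro fun_space.span_minimal) auto
  moreover have "f = 0" if "f \<in> fun_space.span (g ` E)" "T f = 0" for f
    using inj_onD[OF injT, of f 0] that by (simp add: T.zero fun_space.span_zero)
  ultimately show ?thesis
    unfolding lineable_def has_dimension_def
    by (intro exI[of _ "fun_space.span (g ` E)"] conjI exI[of _ "g ` E"])
      (auto intro: fun_space.span_base)
qed

text \<open>A subspace that meets the kernel in \<open>0\<close> only is mapped injectively into \<open>K\<^sup>E\<close>, so it has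
  dimension at most \<open>|E|\<close>.\<close>

lemma not_lineable_complement_of_kernel:
  fixes T :: "('a \<Rightarrow> 'k::field) \<Rightarrow> 'a \<Rightarrow> 'k"
  assumes T: "Vector_Spaces.linear fscale fscale T"
    and range: "\<And>f x. x \<notin> E \<Longrightarrow> T f x = 0" and E: "finite E"
  shows "\<not> lineable fscale (V - {f \<in> V. T f = 0}) ( |E| +c BNF_Cardinal_Arithmetic.cone)"
proof
  interpret T: Vector_Spaces.linear fscale fscale T by (rule T)
  assume "lineable fscale (V - {f \<in> V. T f = 0}) ( |E| +c BNF_Cardinal_Arithmetic.cone)"
  then obtain W B where W: "fun_space.subspace W" "W \<subseteq> V - {f \<in> V. T f = 0} \<union> {0}"
    and B: "fun_space.independent B" "fun_space.span B = W"
    and B_card: "|B| =o |E| +c BNF_Cardinal_Arithmetic.cone"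
    unfolding lineable_def has_dimension_def by (elim exE conjE) (rule that)
  from B_card have "|B| =o |E <+> {()}|"
    by (simp add: csum_def BNF_Cardinal_Arithmetic.cone_def Field_card_of)
  then obtain b where b: "bij_betw b B (E <+> {()})"
    using card_of_ordIso by blast
  have card: "card B = card E + 1"
    using bij_betw_same_card[OF b] E by (simp add: card_Plus)
  have inj: "inj_on T (fun_space.span B)"
    using W B by (subst T.inj_on_iff_eq_0) auto
  then have "fun_space.independent (T ` B)"
    using B(1) by (rule T.independent_injective_image[rotated])
  moreover have "T ` B \<subseteq> fun_space.span (point_mass ` E)"
    by (auto intro!: span_point_masses[OF E] range)
  ultimately have "card (T ` B) \<le> card (point_mass ` E :: ('a \<Rightarrow> 'k) set)"
    using fun_space.independent_span_bound[of "point_mass ` E" "T ` B"] E by auto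
  moreover have "card (T ` B) = card B"
    using inj_on_subset[OF inj fun_space.span_superset] by (rule card_image)
  moreover have "card (point_mass ` E :: ('a \<Rightarrow> 'k) set) \<le> card E"
    by (rule card_image_le[OF E])
  ultimately show False using card by simp
qed

section \<open>Functions that are constant on the classes of a finite relation\<close>

lemma subspace_C_space: "fun_space.subspace (C_space L :: ('a \<Rightarrow> 'k::real_normed_field) set)"
  unfolding fun_space.subspace_def
proof (intro conjI ballI allI)
  fix f g :: "'a \<Rightarrow> 'k" and c
  assume f: "f \<in> C_space L"
  then show "fscale c f \<in> C_space L"
    by (auto simp: C_space_def fscale_def continuous_map_atin intro!: tendsto_mult_left)
  assume "g \<in> C_space L"
  with f show "f + g \<in> C_space L"
    by (simp add: C_space_def plus_fun_def continuous_map_add)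
qed (simp add: C_space_def zero_fun_def)

text \<open>A compact Hausdorff space is normal and its finite subsets are closed, so Urysohn's lemma
  separates a point from finitely many others.\<close>

lemma ex_continuous_isolating_point:
  assumes L: "compact_space L" "Hausdorff_space L"
    and F: "finite F" "F \<subseteq> topspace L" and e: "e \<in> F"
  shows "\<exists>g \<in> C_space L. g e = (1 :: 'k::real_normed_field) \<and> (\<forall>x\<in>F - {e}. g x = 0)"
proof -
  have "normal_space L"
    using L by (simp add: compact_Hausdorff_or_regular_imp_normal_space)
  moreover have "closedin L (F - {e})" "closedin L {e}"
    using F e L(2) by (auto intro!: closedin_Hausdorff_finite)
  ultimately obtain u where u: "continuous_map L euclideanreal u" "u ` (F - {e}) \<subseteq> {0}" "u ` {e} \<subseteq> {1}"
    by (rule Urysohn_lemma_alt) auto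
  define g where "g x = (if x \<in> topspace L then of_real (u x) else 0 :: 'k)" for x
  have "continuous_map L euclidean (of_real \<circ> u :: 'a \<Rightarrow> 'k)"
    by (rule continuous_map_compose[OF u(1)]) (auto intro: continuous_on_of_real continuous_on_id)
  then have "continuous_map L euclidean g"
    by (rule continuous_map_eq) (simp add: g_def)
  then have "g \<in> C_space L" by (simp add: C_space_def g_def)
  moreover have "g e = 1" "\<forall>x\<in>F - {e}. g x = 0"
    using u(2,3) e F by (auto simp: g_def)
  ultimately show ?thesis by blast
qed

text \<open>A function is constant on classes exactly if it agrees with its value at the
  representative, and this is a condition only at the finitely many points outside the set of
  representatives. These conditions are linear, and they are independent on \<open>C_space L\<close>: a
  continuous function that is \<open>1\<close> at \<open>e\<close> and \<open>0\<close> at the other points of \<open>E\<close> and at all their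
  representatives violates only the condition at \<open>e\<close>.\<close>

lemma lineability_of_complement:
  fixes L :: "'a topology" and N :: "('a \<Rightarrow> 'k::real_normed_field) set"
  assumes L: "compact_space L" "Hausdorff_space L"
    and fin: "finite_rel (topspace L) \<rho>" and eq: "equiv (topspace L) \<rho>"
    and N: "N = {f \<in> C_space L. \<forall>(x, y)\<in>\<rho>. f x = f y}"
  shows "lineable fscale (C_space L - N) (ord_rel (topspace L) \<rho>)"
    "\<not> lineable fscale (C_space L - N) (ord_rel (topspace L) \<rho> +c BNF_Cardinal_Arithmetic.cone)"
proof -
  define R where "R = (SOME R. representatives (topspace L) \<rho> R)"
  have R: "representatives (topspace L) \<rho> R"
    unfolding R_def by (rule someI_ex[OF representatives_exist[OF eq]])
  define E where "E = topspace L - R"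
  have ord: "ord_rel (topspace L) \<rho> = |E|"
    by (simp add: ord_rel_def E_def R_def)
  have E: "finite E"
    using fin by (simp add: finite_rel_def ord BNF_Cardinal_Arithmetic.cfinite_def Field_card_of)
  define r where "r x = (THE y. y \<in> R \<inter> \<rho> `` {x})" for x
  have r: "r x \<in> R" "(x, r x) \<in> \<rho>" if "x \<in> topspace L" for x
    using theI'[OF representatives_ex1[OF R that]] by (auto simp: r_def)
  have r_eq: "r x = y" if "y \<in> R" "(x, y) \<in> \<rho>" "x \<in> topspace L" for x y
    unfolding r_def by (rule the1_equality[OF representatives_ex1[OF R that(3)]]) (use that in auto)
  have R_sub: "R \<subseteq> topspace L"
    using R by (simp add: representatives_def)
  define T :: "('a \<Rightarrow> 'k) \<Rightarrow> 'a \<Rightarrow> 'k" where "T f = (\<lambda>x. if x \<in> E then f x - f (r x) else 0)" for f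
  have T: "Vector_Spaces.linear fscale fscale T"
    by unfold_locales (auto simp: T_def fscale_def fun_eq_iff algebra_simps)
  have "T f = 0 \<longleftrightarrow> (\<forall>(x, y)\<in>\<rho>. f x = f y)" for f :: "'a \<Rightarrow> 'k"
  proof
    assume "T f = 0"
    then have "f x = f (r x)" if "x \<in> E" for x
      using that by (auto simp: T_def fun_eq_iff split: if_splits)
    moreover have "r x = x" if "x \<in> R" for x
      using that R_sub eq by (intro r_eq) (auto simp: equiv_def refl_on_def)
    ultimately have fr: "f x = f (r x)" if "x \<in> topspace L" for x
      using that by (cases "x \<in> R") (auto simp: E_def)
    have "f x = f y" if xy: "(x, y) \<in> \<rho>" for x y
    proof -
      have xy_in: "x \<in> topspace L" "y \<in> topspace L"
        using xy eq by (auto simp: equiv_def refl_on_def)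
      then have "r x = r y"
        using xy eq r[of y] by (intro r_eq) (auto simp: equiv_def elim: transE)
      then show ?thesis using fr xy_in by metis
    qed
    then show "\<forall>(x, y)\<in>\<rho>. f x = f y" by auto
  next
    assume "\<forall>(x, y)\<in>\<rho>. f x = f y"
    then show "T f = 0"
      using r(2) by (auto simp: T_def fun_eq_iff E_def)
  qed
  then have N_eq: "N = {f \<in> C_space L. T f = 0}"
    by (simp add: N)
  have onto: "\<exists>g\<in>C_space L. T g = point_mass e" if e: "e \<in> E" for e
  proof -
    have "finite (E \<union> r ` E)" "E \<union> r ` E \<subseteq> topspace L" "e \<in> E \<union> r ` E"
      using E e r R_sub by (auto simp: E_def)
    then obtain g :: "'a \<Rightarrow> 'k" where g: "g \<in> C_space L" "g e = 1" "\<And>x. x \<in> E \<union> r ` E - {e} \<Longrightarrow> g x = 0"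
      using ex_continuous_isolating_point[OF L, of "E \<union> r ` E" e] by metis
    have "r x \<noteq> e" if "x \<in> E" for x
      using r(1)[of x] that e by (auto simp: E_def)
    then have "T g = point_mass e"
      using g(2,3) e by (auto simp: T_def point_mass_def fun_eq_iff)
    then show ?thesis using g(1) by blast
  qed
  show "lineable fscale (C_space L - N) (ord_rel (topspace L) \<rho>)"
    unfolding N_eq ord by (rule lineable_complement_of_kernel[OF T subspace_C_space onto E])
  show "\<not> lineable fscale (C_space L - N) (ord_rel (topspace L) \<rho> +c BNF_Cardinal_Arithmetic.cone)"
    unfolding N_eq ord by (rule not_lineable_complement_of_kernel[OF T _ E]) (simp add: T_def)
qed

theorem theorem3p1:
  fixes L :: "'a topology"
  assumes "compact_space L" and "Hausdorff_space L"
  shows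
    "(\<forall>A :: ('a \<Rightarrow> real) set.
        subalgebra L A \<and> self_adjoint id A \<and> vanishes_nowhere L A \<and>
        finite_rel (topspace L) (same_values L A) \<longrightarrow>
        lineable fscale (C_space L - norm_closure L A)
          (ord_rel (topspace L) (same_values L A)) \<and>
        \<not> lineable fscale (C_space L - norm_closure L A)
          (ord_rel (topspace L) (same_values L A) +c BNF_Cardinal_Arithmetic.cone)) \<and>
     (\<forall>A :: ('a \<Rightarrow> complex) set.
        subalgebra L A \<and> self_adjoint cnj A \<and> vanishes_nowhere L A \<and>
        finite_rel (topspace L) (same_values L A) \<longrightarrow>
        lineable fscale (C_space L - norm_closure L A)
          (ord_rel (topspace L) (same_values L A)) \<and>
        \<not> lineable fscale (C_space L - norm_closure L A)
          (ord_rel (topspace L) (same_values L A) +c BNF_Cardinal_Arithmetic.cone))"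
proof (intro conjI allI impI; elim conjE)
  fix A :: "('a \<Rightarrow> real) set"
  assume A: "subalgebra L A" and "vanishes_nowhere L A"
    and fin: "finite_rel (topspace L) (same_values L A)"
  then have N: "norm_closure L A = {f \<in> C_space L. \<forall>(x, y)\<in>same_values L A. f x = f y}"
    using real_approximation[OF assms(1) A]
    by (intro norm_closure_eq_constant_on_classes[OF assms(1)]) (auto simp: subalgebra_def)
  note lineability_of_complement[OF assms fin equiv_same_values N]
  then show "lineable fscale (C_space L - norm_closure L A) (ord_rel (topspace L) (same_values L A))"
    "\<not> lineable fscale (C_space L - norm_closure L A)
      (ord_rel (topspace L) (same_values L A) +c BNF_Cardinal_Arithmetic.cone)" .
next
  fix A :: "('a \<Rightarrow> complex) set"
  assume A: "subalgebra L A" and "self_adjoint cnj A" and "vanishes_nowhere L A"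
    and fin: "finite_rel (topspace L) (same_values L A)"
  then have N: "norm_closure L A = {f \<in> C_space L. \<forall>(x, y)\<in>same_values L A. f x = f y}"
    using complex_approximation[OF assms(1) A]
    by (intro norm_closure_eq_constant_on_classes[OF assms(1)]) (auto simp: subalgebra_def)
  note lineability_of_complement[OF assms fin equiv_same_values N]
  then show "lineable fscale (C_space L - norm_closure L A) (ord_rel (topspace L) (same_values L A))"
    "\<not> lineable fscale (C_space L - norm_closure L A)
      (ord_rel (topspace L) (same_values L A) +c BNF_Cardinal_Arithmetic.cone)" .
qed

end
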